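(* Assume (A1) and (A2). Let $\{x_t\}$, $\{\lambda_t\}_{t\ge 2}$ be generated by the M-CRM (Algorithm 1). Define $$\Delta_0:=\left(\frac{L+2\theta+(\sigma_{\max}+2\bar\kappa_G+2\bar\kappa_H)\alpha}{2}\right)^{3/2},\qquad \Delta_1:=\frac{24\min_{j\in\mathcal J}[F_j(x_1)-F_j^*]}{(\alpha-1)\sigma_1}+\frac{\alpha+1}{\alpha-1}\|x_1-x_0\|^3,$$ where $\sigma_{\max}:=\sigma_1+2[L+3\alpha(2\bar\kappa_G+\bar\kappa_H)]$. Then, for every $T\ge 2$, $$\sum_{t=1}^{T-1}\|x_t-x_{t-1}\|^3\le\Delta_1,\qquad \sum_{t=2}^{T}\Big\|\sum_{j\in\mathcal J}(\lambda_t)_j\nabla F_j(x_t)\Big\|^{3/2}\le\Delta_0\,\Delta_1 .$$ As a consequence, given $\varepsilon>0$, Algorithm 1 needs at most $\mathcal O\big(\Delta_0\Delta_1\varepsilon^{-3/2}\big)$ (outer) iterations to generate an $\varepsilon$-approximate Pareto critical point of $\min_{x\in\mathbb R^n}F(x)$.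
   Context: Setting: $F=(F_1,\dots,F_m):\mathbb R^n\to\mathbb R^m$ is twice continuously differentiable, $\mathcal J=\{1,\dots,m\}$; $\|\cdot\|$ is the Euclidean norm and the induced operator norm. (A1): for every $j\in\mathcal J$, $\|\nabla^2F_j(y)-\nabla^2F_j(z)\|\le L_j\|y-z\|$ for all $y,z\in\mathbb R^n$; $L:=\max_{j}L_j$. (A2): for every $j\in\mathcal J$ there is $F_j^*\in\mathbb R$ with $F_j(y)\ge F_j^*$ for all $y\in\mathbb R^n$. A point $\bar x$ is an $\varepsilon$-approximate Pareto critical point if there is $\bar\lambda\in\mathbb R^m_+$ with $\sum_j\bar\lambda_j=1$ and $\|\sum_j\bar\lambda_j\nabla F_j(\bar x)\|\le\varepsilon$. Given approximations $\nabla\bar F_j(x)\in\mathbb R^n$ of $\nabla F_j(x)$ and symmetric $\nabla^2\bar F_j(x)\in\mathbb R^{n\times n}$ of $\nabla^2F_j(x)$, set $E^G_j(x):=\nabla F_j(x)-\nabla\bar F_j(x)$, $E^H_j(x):=\nabla^2F_j(x)-\nabla^2\bar F_j(x)$, and for $\sigma>0$ $$M^j_{x,\sigma}(y):=\langle\nabla\bar F_j(x),y-x\rangle+\tfrac12\langle\nabla^2\bar F_j(x)(y-x),y-x\rangle+\tfrac{\sigma}{6}\|y-x\|^3,\qquad M_{x,\sigma}(y):=\max_{j\in\mathcal J}M^j_{x,\sigma}(y).$$ Algorithm 1 (M-CRM). Step 0: choose $x_0,x_1\in\mathbb R^n$, $\sigma_1>0$, $\theta\ge0$, $\alpha>1$,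 $\bar\kappa_G,\bar\kappa_H\ge0$; set $t:=1$. Step 1: let $i\ge0$ be the smallest integer with $\alpha^{i-1}\sigma_t\ge\sigma_1$. Step 1.1: for every $j$ choose $\nabla\bar F_j(x_t),\nabla^2\bar F_j(x_t)$ with $\|E^G_j(x_t)\|\le\frac{\bar\kappa_G}{\alpha^{i-1}}\|x_t-x_{t-1}\|^2$ and $\|E^H_j(x_t)\|\le\frac{\bar\kappa_H}{\alpha^{i-1}}\|x_t-x_{t-1}\|$. Step 1.2: compute $(x^+_{t,i},\lambda^+_{t,i})\in\mathbb R^n\times\mathbb R^m_+$ with $M_{x_t,\alpha^i\sigma_t}(x^+_{t,i})\le0$, $\sum_j(\lambda^+_{t,i})_j=1$, and $\big\|\sum_j(\lambda^+_{t,i})_j\nabla M^j_{x_t,\alpha^i\sigma_t}(x^+_{t,i})\big\|\le\theta\|x^+_{t,i}-x_t\|^2$. Step 1.3: if $F_j(x_t)-F_j(x^+_{t,i})\ge\frac{\alpha^i\sigma_t}{12}\|x^+_{t,i}-x_t\|^3-\frac{\sigma_t}{12}\|x_t-x_{t-1}\|^3$ for all $j\in\mathcal J$, set $i_t=i$ and go to Step 2; otherwise set $i:=i+1$ and go to Step 1.1. Step 2: set $x_{t+1}=x^+_{t,i_t}$, $\lambda_{t+1}=\lambda^+_{t,i_t}$, $\sigma_{t+1}=\alpha^{i_t-1}\sigma_t$, $t:=t+1$, and go to Step 1. Outer iterations are indexed by $t$. $\mathcal O(\cdot)$ hides an absolute multiplicative constant and an absolute additive constant. *)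

theory Defs
  imports "HOL-Analysis.Analysis"
begin

definition grad :: "(real^'n \<Rightarrow> real) \<Rightarrow> real^'n \<Rightarrow> real^'n" where
  "grad f x = (THE g. GDERIV f x :> g)"

definition hess :: "(real^'n \<Rightarrow> real) \<Rightarrow> real^'n \<Rightarrow> real^'n^'n" where
  "hess f x = jacobian (grad f) (at x)"

lemma grad_eqI:
  assumes "GDERIV f x :> g"
  shows "grad f x = g"
  unfolding grad_def
proof (rule the_equality)
  show "GDERIV f x :> g" by (fact assms)
next
  fix h assume "GDERIV f x :> h"
  then have "(\<lambda>u. inner u h) = (\<lambda>u. inner u g)"
    using assms unfolding gderiv_def by (rule has_derivative_unique)
  then have "inner (h - g) h = inner (h - g) g" by meson
  then have "inner (h - g) (h - g) = 0" by (simp add: inner_diff_right)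
  then show "h = g" by simp
qed

abbreviation objective :: "(real^'n \<Rightarrow> real^'m) \<Rightarrow> 'm \<Rightarrow> real^'n \<Rightarrow> real" where
  "objective F j \<equiv> (\<lambda>y. F y $ j)"

definition twice_cont_diff :: "(real^'n \<Rightarrow> real^'m) \<Rightarrow> bool" where
  "twice_cont_diff F \<longleftrightarrow> (\<forall>j.
     (\<forall>x. objective F j differentiable (at x)) \<and>
     (\<forall>x. grad (objective F j) differentiable (at x)) \<and>
     continuous_on UNIV (hess (objective F j)))"

text \<open>The norm of the type \<^typ>\<open>real^'n^'n\<close> is the Frobenius norm, not the norm
  induced by the Euclidean norm.\<close>

definition matrix_opnorm :: "real^'n^'n \<Rightarrow> real" where
  "matrix_opnorm A = onorm ((*v) A)"

definition unit_simplex :: "(real^'m) set" where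
  "unit_simplex = {l. (\<forall>j. 0 \<le> l $ j) \<and> (\<Sum>j\<in>UNIV. l $ j) = 1}"

definition approx_Pareto_critical ::
  "(real^'n \<Rightarrow> real^'m) \<Rightarrow> real \<Rightarrow> real^'n \<Rightarrow> bool" where
  "approx_Pareto_critical F \<epsilon> x \<longleftrightarrow>
     (\<exists>l\<in>unit_simplex. norm (\<Sum>j\<in>UNIV. (l $ j) *\<^sub>R grad (objective F j) x) \<le> \<epsilon>)"

definition cubic_model ::
  "real^'n \<Rightarrow> real^'n^'n \<Rightarrow> real^'n \<Rightarrow> real \<Rightarrow> real^'n \<Rightarrow> real" where
  "cubic_model g H x \<sigma> y =
     g \<bullet> (y - x) + (1/2) * ((H *v (y - x)) \<bullet> (y - x)) + (\<sigma>/6) * norm (y - x) ^ 3"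

definition max_cubic_model ::
  "('m::finite \<Rightarrow> real^'n) \<Rightarrow> ('m \<Rightarrow> real^'n^'n) \<Rightarrow> real^'n \<Rightarrow> real \<Rightarrow> real^'n \<Rightarrow> real" where
  "max_cubic_model g H x \<sigma> y = Max (range (\<lambda>j. cubic_model (g j) (H j) x \<sigma> y))"

text \<open>Steps 1.1 and 1.2 for the inner index \<open>i\<close>, current point \<open>x\<close>, previous point \<open>xprev\<close>.
  The exponent \<open>i - 1\<close> may be \<open>-1\<close>, hence the integer power.\<close>

definition mcrm_trial ::
  "(real^'n \<Rightarrow> real^'m) \<Rightarrow> real \<Rightarrow> real \<Rightarrow> real \<Rightarrow> real \<Rightarrow> real^'n \<Rightarrow> real^'n \<Rightarrow> real \<Rightarrow> nat \<Rightarrow>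
   ('m \<Rightarrow> real^'n) \<Rightarrow> ('m \<Rightarrow> real^'n^'n) \<Rightarrow> real^'n \<Rightarrow> real^'m \<Rightarrow> bool" where
  "mcrm_trial F \<theta> \<alpha> \<kappa>G \<kappa>H xprev x \<sigma> i g H xplus lplus \<longleftrightarrow>
     (\<forall>j. transpose (H j) = H j \<and>
          norm (grad (objective F j) x - g j)
            \<le> \<kappa>G / (\<alpha> powi (int i - 1)) * norm (x - xprev) ^ 2 \<and>
          matrix_opnorm (hess (objective F j) x - H j)
            \<le> \<kappa>H / (\<alpha> powi (int i - 1)) * norm (x - xprev)) \<and>
     max_cubic_model g H x (\<alpha> ^ i * \<sigma>) xplus \<le> 0 \<and>
     lplus \<in> unit_simplex \<and>
     norm (\<Sum>j\<in>UNIV. (lplus $ j) *\<^sub>R grad (cubic_model (g j) (H j) x (\<alpha> ^ i * \<sigma>)) xplus)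
       \<le> \<theta> * norm (xplus - x) ^ 2"

definition mcrm_accept ::
  "(real^'n \<Rightarrow> real^'m) \<Rightarrow> real \<Rightarrow> real^'n \<Rightarrow> real^'n \<Rightarrow> real \<Rightarrow> nat \<Rightarrow> real^'n \<Rightarrow> bool" where
  "mcrm_accept F \<alpha> xprev x \<sigma> i xplus \<longleftrightarrow>
     (\<forall>j. F x $ j - F xplus $ j
            \<ge> \<alpha> ^ i * \<sigma> / 12 * norm (xplus - x) ^ 3 - \<sigma> / 12 * norm (x - xprev) ^ 3)"

text \<open>One outer iteration. The inner loop runs over \<open>i0, \<dots>, it\<close>; at every inner index the
  approximations \<open>g i\<close>, \<open>H i\<close> are chosen anew, all trial points before \<open>it\<close> are rejected, and
  the one at \<open>it\<close> is accepted.\<close>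

definition mcrm_step ::
  "(real^'n \<Rightarrow> real^'m) \<Rightarrow> real \<Rightarrow> real \<Rightarrow> real \<Rightarrow> real \<Rightarrow> real \<Rightarrow>
   real^'n \<Rightarrow> real^'n \<Rightarrow> real \<Rightarrow> real^'n \<Rightarrow> real^'m \<Rightarrow> real \<Rightarrow> bool" where
  "mcrm_step F \<theta> \<alpha> \<kappa>G \<kappa>H \<sigma>1 xprev x \<sigma> xnext lnext \<sigma>next \<longleftrightarrow>
     (\<exists>i0 it g H xplus lplus.
        i0 = (LEAST i::nat. \<alpha> powi (int i - 1) * \<sigma> \<ge> \<sigma>1) \<and> i0 \<le> it \<and>
        (\<forall>i\<in>{i0..it}. mcrm_trial F \<theta> \<alpha> \<kappa>G \<kappa>H xprev x \<sigma> i (g i) (H i) (xplus i) (lplus i)) \<and>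
        (\<forall>i\<in>{i0..<it}. \<not> mcrm_accept F \<alpha> xprev x \<sigma> i (xplus i)) \<and>
        mcrm_accept F \<alpha> xprev x \<sigma> it (xplus it) \<and>
        xnext = xplus it \<and> lnext = lplus it \<and> \<sigma>next = \<alpha> powi (int it - 1) * \<sigma>)"

text \<open>\<open>x\<close>, \<open>lam\<close> and \<open>\<sigma>\<close> are sequences generated by the algorithm. Only \<open>x t\<close> for \<open>t \<ge> 0\<close>,
  \<open>\<sigma> t\<close> for \<open>t \<ge> 1\<close> and \<open>lam t\<close> for \<open>t \<ge> 2\<close> are meaningful.\<close>

definition mcrm_generates ::
  "(real^'n \<Rightarrow> real^'m) \<Rightarrow> real \<Rightarrow> real \<Rightarrow> real \<Rightarrow> real \<Rightarrow>
   (nat \<Rightarrow> real^'n) \<Rightarrow> (nat \<Rightarrow> real^'m) \<Rightarrow> (nat \<Rightarrow> real) \<Rightarrow> bool" where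
  "mcrm_generates F \<theta> \<alpha> \<kappa>G \<kappa>H x lam \<sigma> \<longleftrightarrow>
     \<sigma> 1 > 0 \<and> \<theta> \<ge> 0 \<and> \<alpha> > 1 \<and> \<kappa>G \<ge> 0 \<and> \<kappa>H \<ge> 0 \<and>
     (\<forall>t\<ge>1. mcrm_step F \<theta> \<alpha> \<kappa>G \<kappa>H (\<sigma> 1) (x (t - 1)) (x t) (\<sigma> t)
              (x (t + 1)) (lam (t + 1)) (\<sigma> (t + 1)))"

end

theory Submission
  imports Defs
begin

text \<open>Write \<open>d t = norm (x t - x (t - 1))\<close>. By Taylor's formula every trial point with
  \<open>\<alpha> ^ i * \<sigma> t \<ge> 2 * (L + 3 * \<alpha> * (2 * \<kappa>G + \<kappa>H))\<close> is accepted, so \<open>\<sigma> t\<close> stays in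
  \<open>{\<sigma> 1..\<sigma>max}\<close>. An accepted step decreases every \<open>F\<^sub>j\<close> by at least
  \<open>\<alpha> * \<sigma> (t + 1) / 12 * d (t + 1) ^ 3 - \<sigma> t / 12 * d t ^ 3\<close>; as \<open>\<alpha> > 1\<close>, telescoping bounds
  the sum of the \<open>d t ^ 3\<close>. The approximate stationarity of the model and the error bounds control the
  aggregated gradient at \<open>x (t + 1)\<close> by a multiple of \<open>max (d t) (d (t + 1)) ^ 2\<close>, whose power
  \<open>3/2\<close> is at most the same power of the constant times \<open>d t ^ 3 + d (t + 1) ^ 3\<close>.\<close>

section \<open>Gradients, Hessians and Taylor estimates\<close>

text \<open>The vector of the values of the derivative on the basis represents it by an inner
  product; uniqueness of gradients then identifies this vector with the description
  \<open>grad f x\<close>.\<close>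

lemma GDERIV_grad:
  fixes f :: "real^'n \<Rightarrow> real"
  assumes "f differentiable (at x)"
  shows "GDERIV f x :> grad f x"
proof -
  obtain f' where f': "(f has_derivative f') (at x)"
    using assms by (auto simp: differentiable_def)
  interpret bounded_linear f' using f' by (rule has_derivative_bounded_linear)
  define g where "g = (\<Sum>b\<in>Basis. f' b *\<^sub>R b)"
  have "f' h = h \<bullet> g" for h
  proof -
    have "f' h = f' (\<Sum>b\<in>Basis. (h \<bullet> b) *\<^sub>R b)"
      by (simp only: euclidean_representation)
    also have "\<dots> = h \<bullet> g"
      by (simp add: g_def sum scaleR inner_sum_right mult.commute)
    finally show ?thesis .
  qed
  then have "f' = (\<lambda>h. h \<bullet> g)" by blast
  then have "GDERIV f x :> g" using f' by (simp add: gderiv_def)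
  then show ?thesis using grad_eqI by metis
qed

lemma has_derivative_hess:
  assumes "grad f differentiable (at x)"
  shows "(grad f has_derivative (\<lambda>h. hess f x *v h)) (at x)"
  using assms unfolding hess_def by (simp add: jacobian_works)

lemma matrix_opnorm_bound: "norm (A *v v) \<le> matrix_opnorm A * norm v"
  unfolding matrix_opnorm_def by (rule onorm) simp

lemma matrix_opnorm_nonneg: "0 \<le> matrix_opnorm A"
  unfolding matrix_opnorm_def by (rule onorm_pos_le) simp

text \<open>Along the segment, \<open>?p 1 - ?p 0\<close> is the remainder. Its derivative is a
  Hessian difference applied to \<open>s\<close>, of norm at most \<open>?q' t\<close> by the
  Lipschitz bound, and the mean value inequality with majorant \<open>?q\<close> integrates this
  estimate.\<close>

lemma grad_taylor_bound:
  fixes f :: "real^'n \<Rightarrow> real"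
  assumes diff: "\<And>x. grad f differentiable (at x)"
    and lip: "\<And>y z. matrix_opnorm (hess f y - hess f z) \<le> L * norm (y - z)"
  shows "norm (grad f (x + s) - grad f x - hess f x *v s) \<le> L / 2 * norm s ^ 2"
proof -
  let ?p = "\<lambda>t::real. grad f (x + t *\<^sub>R s) - t *\<^sub>R (hess f x *v s)"
  let ?p' = "\<lambda>t::real. hess f (x + t *\<^sub>R s) *v s - hess f x *v s"
  have d: "(?p has_vector_derivative ?p' t) (at t)" for t
  proof -
    have "((\<lambda>t. x + t *\<^sub>R s) has_derivative (\<lambda>h. h *\<^sub>R s)) (at t)"
      by (auto intro!: derivative_eq_intros)
    from has_derivative_compose[OF this has_derivative_hess[OF diff]]
    have "((\<lambda>t. grad f (x + t *\<^sub>R s)) has_vector_derivative hess f (x + t *\<^sub>R s) *v s) (at t)"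
      by (simp add: has_vector_derivative_def matrix_vector_mult_scaleR)
    then show ?thesis by (auto intro!: derivative_eq_intros)
  qed
  let ?q = "\<lambda>t::real. L / 2 * norm s ^ 2 * t ^ 2"
  let ?q' = "\<lambda>t::real. L * norm s ^ 2 * t"
  have q: "(?q has_vector_derivative ?q' t) (at t)" for t
    unfolding has_real_derivative_iff_has_vector_derivative[symmetric]
    by (auto intro!: derivative_eq_intros)
  have "norm (?p 1 - ?p 0) \<le> ?q 1 - ?q 0"
  proof (rule differentiable_bound_general)
    show "continuous_on {0..1} ?p" "continuous_on {0..1} ?q"
      using d q by (meson has_vector_derivative_at_within has_vector_derivative_continuous
        continuous_at_imp_continuous_on)+
    fix t :: real assume t: "0 < t" "t < 1"
    have "norm (?p' t) \<le> matrix_opnorm (hess f (x + t *\<^sub>R s) - hess f x) * norm s"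
      using matrix_opnorm_bound by (metis matrix_vector_mult_diff_rdistrib)
    also have "\<dots> \<le> (L * norm (x + t *\<^sub>R s - x)) * norm s"
      by (rule mult_right_mono[OF lip]) simp
    also have "\<dots> = ?q' t" using t by (simp add: power2_eq_square)
    finally show "norm (?p' t) \<le> ?q' t" .
  qed (simp, rule d, rule q)
  then show ?thesis by (simp add: algebra_simps)
qed

text \<open>The same argument one order higher: the derivative along the segment is now controlled
  by \<open>grad_taylor_bound\<close>.\<close>

lemma taylor_bound:
  fixes f :: "real^'n \<Rightarrow> real"
  assumes diff0: "\<And>x. f differentiable (at x)" and diff: "\<And>x. grad f differentiable (at x)"
    and lip: "\<And>y z. matrix_opnorm (hess f y - hess f z) \<le> L * norm (y - z)"
  shows "\<bar>f (x + s) - f x - grad f x \<bullet> s - (hess f x *v s) \<bullet> s / 2\<bar> \<le> L / 6 * norm s ^ 3"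
proof -
  let ?p = "\<lambda>t::real. f (x + t *\<^sub>R s) - t * (grad f x \<bullet> s) - t ^ 2 * ((hess f x *v s) \<bullet> s / 2)"
  \<comment> \<open>The Hessian term is written with the increment \<open>t *\<^sub>R s\<close>, so
    that the first-order estimate applies to it directly.\<close>
  let ?p' = "\<lambda>t::real. (grad f (x + t *\<^sub>R s) - grad f x - hess f x *v (t *\<^sub>R s)) \<bullet> s"
  have d: "(?p has_vector_derivative ?p' t) (at t)" for t
  proof -
    have "((\<lambda>t. x + t *\<^sub>R s) has_derivative (\<lambda>h. h *\<^sub>R s)) (at t)"
      by (auto intro!: derivative_eq_intros)
    from has_derivative_compose[OF this GDERIV_grad[OF diff0, unfolded gderiv_def]]
    have "((\<lambda>t. f (x + t *\<^sub>R s)) has_real_derivative grad f (x + t *\<^sub>R s) \<bullet> s) (at t)"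
      by (simp add: has_field_derivative_def inner_commute mult_commute_abs)
    note [derivative_intros] = this
    have "(?p has_real_derivative ?p' t) (at t)"
      by (auto intro!: derivative_eq_intros simp: inner_diff_left matrix_vector_mult_scaleR)
    then show ?thesis by (simp only: has_real_derivative_iff_has_vector_derivative)
  qed
  let ?q = "\<lambda>t::real. L / 6 * norm s ^ 3 * t ^ 3"
  let ?q' = "\<lambda>t::real. L / 2 * norm s ^ 3 * t ^ 2"
  have q: "(?q has_vector_derivative ?q' t) (at t)" for t
    unfolding has_real_derivative_iff_has_vector_derivative[symmetric]
    by (auto intro!: derivative_eq_intros)
  have "norm (?p 1 - ?p 0) \<le> ?q 1 - ?q 0"
  proof (rule differentiable_bound_general)
    show "continuous_on {0..1} ?p" "continuous_on {0..1} ?q"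
      using d q by (meson has_vector_derivative_at_within has_vector_derivative_continuous
        continuous_at_imp_continuous_on)+
    fix t :: real assume t: "0 < t" "t < 1"
    have "norm (?p' t) \<le> norm (grad f (x + t *\<^sub>R s) - grad f x - hess f x *v (t *\<^sub>R s)) * norm s"
      using Cauchy_Schwarz_ineq2 by simp
    also have "\<dots> \<le> (L / 2 * norm (t *\<^sub>R s) ^ 2) * norm s"
      by (rule mult_right_mono[OF grad_taylor_bound[OF diff lip]]) simp
    also have "\<dots> = ?q' t" by (simp add: power2_eq_square power3_eq_cube)
    finally show "norm (?p' t) \<le> ?q' t" .
  qed (simp, rule d, rule q)
  then show ?thesis by (simp add: algebra_simps)
qed

section \<open>Derivative of the cubic model\<close>

text \<open>The origin needs its own argument because the norm itself is not differentiable there;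
  it does occur, since a trial point may coincide with the current point.\<close>

lemma has_derivative_norm_cubed:
  fixes u :: "'a::real_inner"
  shows "((\<lambda>v. norm v ^ 3) has_derivative (\<lambda>h. 3 * norm u * (u \<bullet> h))) (at u)"
proof (cases "u = 0")
  case True
  have "((\<lambda>h::'a. norm h ^ 2) \<longlongrightarrow> 0) (at 0)"
    by (auto intro!: tendsto_eq_intros)
  \<comment> \<open>This is the difference quotient at the origin. The identity also holds for
    \<open>h = 0\<close>, where division by zero gives zero.\<close>
  moreover have "norm h ^ 2 = norm (norm h ^ 3) / norm h" for h :: 'a
    by (simp add: power2_eq_square power3_eq_cube)
  ultimately show ?thesis
    using True by (simp add: has_derivative_at power3_eq_cube)
next
  case False
  then show ?thesis
    by (auto intro!: derivative_eq_intros has_derivative_norm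
        simp: sgn_div_norm power2_eq_square fun_eq_iff inner_commute field_simps)
qed

text \<open>Symmetry of \<open>H\<close> makes the two terms of the product rule for the quadratic
  part coincide, which cancels the factor 1/2.\<close>

lemma grad_cubic_model:
  fixes g :: "real^'n"
  assumes "transpose H = H"
  shows "grad (cubic_model g H x \<sigma>) y
    = g + H *v (y - x) + (\<sigma> / 2 * norm (y - x)) *\<^sub>R (y - x)"
proof (rule grad_eqI)
  have shift: "((\<lambda>y. y - x) has_derivative (\<lambda>h. h)) (at y)"
    by (auto intro!: derivative_eq_intros)
  note Hshift = bounded_linear.has_derivative[OF matrix_vector_mul_bounded_linear shift, of H]
  have sym: "(H *v h) \<bullet> (y - x) = h \<bullet> (H *v (y - x))" for h
    by (metis assms dot_lmul_matrix inner_commute vector_transpose_matrix)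
  have "(cubic_model g H x \<sigma> has_derivative (\<lambda>h. g \<bullet> h
      + 1/2 * ((H *v (y - x)) \<bullet> h + (H *v h) \<bullet> (y - x))
      + \<sigma>/6 * (3 * norm (y - x) * ((y - x) \<bullet> h)))) (at y)"
    unfolding cubic_model_def[abs_def]
    by (intro has_derivative_add has_derivative_mult_right has_derivative_inner_right[OF shift]
        has_derivative_inner[OF Hshift shift] has_derivative_compose[OF shift has_derivative_norm_cubed])
  then show "GDERIV (cubic_model g H x \<sigma>) y :> g + H *v (y - x) + (\<sigma> / 2 * norm (y - x)) *\<^sub>R (y - x)"
    unfolding gderiv_def
    by (rule has_derivative_eq_rhs)
       (simp add: fun_eq_iff inner_add_right inner_commute[of g] inner_commute[of "y - x"]
         inner_commute[of "H *v (y - x)"] sym)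
qed

section \<open>Acceptance of trial points with large regularization weight\<close>

text \<open>Here \<open>S = \<alpha> ^ i * \<sigma>\<close> and \<open>c = 1 / \<alpha> ^ (i - 1)\<close>, so that \<open>c * S = \<alpha> * \<sigma>\<close>.
  If \<open>s \<le> d\<close>, the error terms are absorbed by \<open>\<sigma> / 12 * d ^ 3\<close>, otherwise by
  \<open>S / 12 * s ^ 3\<close>.\<close>

lemma cubic_descent_arith:
  fixes c :: real
  assumes nonneg: "0 \<le> d" "0 \<le> s" "0 \<le> \<kappa>G" "0 \<le> \<kappa>H" "0 \<le> L" and c: "0 < c" "c \<le> \<alpha>"
    and cS: "c * S = \<alpha> * \<sigma>" and large: "2 * (L + 3 * \<alpha> * (2 * \<kappa>G + \<kappa>H)) \<le> S"
  shows "\<kappa>G * c * d\<^sup>2 * s + \<kappa>H * c / 2 * d * s\<^sup>2 + L / 6 * s ^ 3 \<le> S / 12 * s ^ 3 + \<sigma> / 12 * d ^ 3"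
proof -
  \<comment> \<open>\<open>K\<close> collects both error coefficients; in terms of it the threshold
    on \<open>S\<close> reads \<open>2 * L + 12 * (\<alpha> * K) \<le> S\<close>.\<close>
  define K where "K = \<kappa>G + \<kappa>H / 2"
  have K: "0 \<le> K" "2 * L + 12 * (\<alpha> * K) \<le> S"
    using nonneg(3,4) large by (simp_all add: K_def algebra_simps)
  have bound: "\<kappa>G * c * d\<^sup>2 * s + \<kappa>H * c / 2 * d * s\<^sup>2 \<le> c * K * m ^ 3"
    if "d \<le> m" "s \<le> m" for m
  proof -
    have "d\<^sup>2 * s \<le> m\<^sup>2 * m" "d * s\<^sup>2 \<le> m * m\<^sup>2"
      using that nonneg by (simp_all add: mult_mono power_mono)
    then have "d\<^sup>2 * s \<le> m ^ 3" "d * s\<^sup>2 \<le> m ^ 3"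
      by (simp_all add: power2_eq_square power3_eq_cube)
    then have "\<kappa>G * c * (d\<^sup>2 * s) \<le> \<kappa>G * c * m ^ 3" "\<kappa>H * c / 2 * (d * s\<^sup>2) \<le> \<kappa>H * c / 2 * m ^ 3"
      using nonneg c by (simp_all only: mult_left_mono mult_nonneg_nonneg less_imp_le divide_nonneg_pos zero_less_numeral)
    then show ?thesis by (simp add: K_def algebra_simps)
  qed
  show ?thesis
  proof (cases "s \<le> d")
    case True
    have "0 < \<alpha>" using c by simp
    \<comment> \<open>Multiplication by \<open>c\<close> trades the weight \<open>S\<close> for
      \<open>\<alpha> * \<sigma>\<close>, which brings the error coefficient \<open>c * K\<close>
      below the tolerated \<open>\<sigma> / 12\<close>.\<close>
    have "c * (12 * (\<alpha> * K)) \<le> c * S"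
      by (rule mult_left_mono) (use K nonneg c in linarith)+
    then have "\<alpha> * (12 * (c * K)) \<le> \<alpha> * \<sigma>" using cS by (simp add: algebra_simps)
    then have "c * K \<le> \<sigma> / 12" using \<open>0 < \<alpha>\<close> by simp
    then have "c * K * d ^ 3 \<le> \<sigma> / 12 * d ^ 3"
      using nonneg by (intro mult_right_mono) auto
    moreover have "L / 6 * s ^ 3 \<le> S / 12 * s ^ 3"
    proof (intro mult_right_mono)
      have "0 \<le> \<alpha> * K" using K \<open>0 < \<alpha>\<close> by simp
      then show "L / 6 \<le> S / 12" using K by simp
    qed (use nonneg in simp)
    ultimately show ?thesis using bound[OF order_refl True] by linarith
  next
    case False
    \<comment> \<open>Here the threshold is used in full:
      \<open>\<alpha> * K + L / 6 \<le> S / 12\<close>.\<close>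
    have "c * K \<le> \<alpha> * K" using c K by (intro mult_right_mono) auto
    then have "(c * K + L / 6) * s ^ 3 \<le> S / 12 * s ^ 3"
      by (intro mult_right_mono zero_le_power) (use nonneg K in linarith)+
    \<comment> \<open>The sign of \<open>\<sigma>\<close> is inherited from \<open>S\<close> through
      \<open>c * S = \<alpha> * \<sigma>\<close>.\<close>
    moreover have "0 \<le> \<sigma> / 12 * d ^ 3"
    proof -
      have "0 \<le> \<alpha> * K" using c K by simp
      then have "0 \<le> S" using nonneg K by linarith
      then have "0 \<le> c * S" using c by simp
      then have "0 \<le> \<sigma>" using cS c by (simp add: zero_le_mult_iff)
      then show ?thesis using nonneg(1) by simp
    qed
    moreover have "\<kappa>G * c * d\<^sup>2 * s + \<kappa>H * c / 2 * d * s\<^sup>2 \<le> c * K * s ^ 3"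
      using False by (intro bound) simp_all
    ultimately show ?thesis unfolding distrib_right by linarith
  qed
qed

text \<open>Trades the exponent \<open>i - 1\<close>, possibly negative, for the factor
  \<open>\<alpha> / \<alpha> ^ i\<close>, which plays the role of \<open>c\<close> in the arithmetic
  above.\<close>

lemma mcrm_trial_error:
  assumes "mcrm_trial F \<theta> \<alpha> \<kappa>G \<kappa>H xp x \<sigma> i g H y l" and "0 < \<alpha>"
  shows "norm (grad (objective F j) x - g j) \<le> \<kappa>G * (\<alpha> / \<alpha> ^ i) * norm (x - xp) ^ 2"
    and "matrix_opnorm (hess (objective F j) x - H j) \<le> \<kappa>H * (\<alpha> / \<alpha> ^ i) * norm (x - xp)"
proof -
  have "\<alpha> powi (int i - 1) = \<alpha> ^ i / \<alpha>"
    using assms by (simp add: power_int_diff)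
  then show "norm (grad (objective F j) x - g j) \<le> \<kappa>G * (\<alpha> / \<alpha> ^ i) * norm (x - xp) ^ 2"
    and "matrix_opnorm (hess (objective F j) x - H j) \<le> \<kappa>H * (\<alpha> / \<alpha> ^ i) * norm (x - xp)"
    using assms(1) by (auto simp: mcrm_trial_def)
qed

text \<open>A nonpositive model value gives the decrease \<open>S / 6 * norm s ^ 3\<close>, up to
  the Taylor remainder and the two data errors. For large \<open>S\<close> these cost at most half
  of that decrease plus the term in \<open>\<sigma>\<close> that the acceptance test
  tolerates.\<close>

lemma mcrm_trial_accept:
  assumes C2: "twice_cont_diff F"
    and lip: "\<And>j y z. matrix_opnorm (hess (objective F j) y - hess (objective F j) z) \<le> L * norm (y - z)"
    and const: "0 \<le> L" "0 \<le> \<kappa>G" "0 \<le> \<kappa>H" "1 < \<alpha>" "0 < \<sigma>"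
    and trial: "mcrm_trial F \<theta> \<alpha> \<kappa>G \<kappa>H xp x \<sigma> i g H y l"
    and large: "2 * (L + 3 * \<alpha> * (2 * \<kappa>G + \<kappa>H)) \<le> \<alpha> ^ i * \<sigma>"
  shows "mcrm_accept F \<alpha> xp x \<sigma> i y"
  unfolding mcrm_accept_def
proof
  fix j
  define s d c S where "s = y - x" and "d = norm (x - xp)" and "c = \<alpha> / \<alpha> ^ i" and "S = \<alpha> ^ i * \<sigma>"
  have "0 < c" "c * S = \<alpha> * \<sigma>" using const by (auto simp: c_def S_def)
  have "c \<le> \<alpha>" using const by (simp add: c_def field_simps)
  let ?f = "objective F j"
  have "?f y - ?f x \<le> grad ?f x \<bullet> s + (hess ?f x *v s) \<bullet> s / 2 + L / 6 * norm s ^ 3"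
    using taylor_bound[of ?f L x s, THEN abs_le_D1] C2 lip by (auto simp: s_def twice_cont_diff_def)
  moreover have "g j \<bullet> s + (H j *v s) \<bullet> s / 2 + S / 6 * norm s ^ 3 \<le> 0"
  proof -
    have "cubic_model (g j) (H j) x S y \<le> max_cubic_model g H x S y"
      unfolding max_cubic_model_def by (rule Max_ge) auto
    also have "\<dots> \<le> 0" using trial by (simp add: mcrm_trial_def S_def)
    finally show ?thesis by (simp add: cubic_model_def s_def)
  qed
  moreover have "grad ?f x \<bullet> s - g j \<bullet> s \<le> \<kappa>G * c * d\<^sup>2 * norm s"
  proof -
    have "grad ?f x \<bullet> s - g j \<bullet> s \<le> norm (grad ?f x - g j) * norm s"
      unfolding inner_diff_left[symmetric] by (rule norm_cauchy_schwarz)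
    also have "\<dots> \<le> \<kappa>G * c * d\<^sup>2 * norm s"
      unfolding c_def d_def by (rule mult_right_mono[OF mcrm_trial_error(1)[OF trial]]) (use const in simp_all)
    finally show ?thesis .
  qed
  moreover have "(hess ?f x *v s) \<bullet> s - (H j *v s) \<bullet> s \<le> \<kappa>H * c * d * norm s ^ 2"
  proof -
    have "(hess ?f x *v s) \<bullet> s - (H j *v s) \<bullet> s \<le> norm ((hess ?f x - H j) *v s) * norm s"
      unfolding matrix_vector_mult_diff_rdistrib inner_diff_left[symmetric] by (rule norm_cauchy_schwarz)
    also have "\<dots> \<le> (matrix_opnorm (hess ?f x - H j) * norm s) * norm s"
      by (intro mult_right_mono matrix_opnorm_bound) auto
    also have "\<dots> \<le> (\<kappa>H * c * d * norm s) * norm s"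
      unfolding c_def d_def mult.assoc[symmetric]
      by (intro mult_right_mono mcrm_trial_error(2)[OF trial]) (use const in simp_all)
    finally show ?thesis by (simp add: power2_eq_square mult.assoc)
  qed
  moreover have "\<kappa>G * c * d\<^sup>2 * norm s + \<kappa>H * c / 2 * d * norm s ^ 2 + L / 6 * norm s ^ 3
      \<le> S / 12 * norm s ^ 3 + \<sigma> / 12 * d ^ 3"
    by (rule cubic_descent_arith[OF _ _ const(2,3,1) \<open>0 < c\<close> \<open>c \<le> \<alpha>\<close> \<open>c * S = \<alpha> * \<sigma>\<close>
          large[folded S_def]]) (simp_all add: d_def)
  ultimately have "?f y - ?f x \<le> \<sigma> / 12 * d ^ 3 - S / 12 * norm s ^ 3" by simp
  then show "F x $ j - F y $ j
      \<ge> \<alpha> ^ i * \<sigma> / 12 * norm (y - x) ^ 3 - \<sigma> / 12 * norm (x - xp) ^ 3"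
    by (simp add: d_def S_def s_def)
qed

section \<open>Aggregated gradient at a trial point\<close>

lemma unit_simplex_norm_sum_le:
  fixes v :: "'m::finite \<Rightarrow> 'a::real_normed_vector"
  assumes l: "l \<in> unit_simplex" and b: "\<And>j. norm (v j) \<le> B"
  shows "norm (\<Sum>j\<in>UNIV. l $ j *\<^sub>R v j) \<le> B"
proof -
  have "norm (\<Sum>j\<in>UNIV. l $ j *\<^sub>R v j) \<le> (\<Sum>j\<in>UNIV. l $ j * B)"
    using l b by (intro sum_norm_le) (auto simp: unit_simplex_def intro: mult_left_mono)
  also have "\<dots> = B" using l by (simp add: unit_simplex_def flip: sum_distrib_right)
  finally show ?thesis .
qed

text \<open>For each objective, the true gradient differs from the model gradient by a Taylor
  remainder, two data errors and the cubic term, each of order \<open>m\<^sup>2\<close> for the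
  larger step length \<open>m\<close>. Convex weights preserve the bound, and approximate
  stationarity of the model adds \<open>\<theta> * m\<^sup>2\<close>.\<close>

lemma mcrm_trial_gradient_bound:
  assumes C2: "twice_cont_diff F"
    and lip: "\<And>j y z. matrix_opnorm (hess (objective F j) y - hess (objective F j) z) \<le> L * norm (y - z)"
    and const: "0 \<le> L" "0 \<le> \<kappa>G" "0 \<le> \<kappa>H" "1 < \<alpha>" "0 \<le> \<theta>" "0 < \<sigma>"
    and trial: "mcrm_trial F \<theta> \<alpha> \<kappa>G \<kappa>H xp x \<sigma> i g H y l"
    and S: "\<alpha> ^ i * \<sigma> \<le> \<alpha> * \<sigma>max"
  obtains m where "m \<in> {norm (x - xp), norm (y - x)}"
    "norm (\<Sum>j\<in>UNIV. l $ j *\<^sub>R grad (objective F j) y)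
      \<le> (L + 2 * \<theta> + (\<sigma>max + 2 * \<kappa>G + 2 * \<kappa>H) * \<alpha>) / 2 * m ^ 2"
proof -
  define m where "m = max (norm (x - xp)) (norm (y - x))"
  define s d S where "s = y - x" and "d = norm (x - xp)" and "S = \<alpha> ^ i * \<sigma>"
  have l: "l \<in> unit_simplex" using trial by (simp add: mcrm_trial_def)
  have d: "0 \<le> d" "d \<le> m" "0 \<le> m" "norm s \<le> m" 
    by (simp_all add: d_def s_def m_def le_max_iff_disj)
  have m2: "norm s ^ 2 \<le> m ^ 2" "d\<^sup>2 \<le> m\<^sup>2" "d * norm s \<le> m\<^sup>2"
    using d by (auto simp: power2_eq_square intro!: mult_mono)
  have c: "\<alpha> / \<alpha> ^ i \<le> \<alpha>" "0 < \<alpha> / \<alpha> ^ i" using const by (auto simp: field_simps)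
  have S0: "0 < S" using const by (simp add: S_def)
  let ?M = "\<lambda>j. grad (cubic_model (g j) (H j) x S) y"
  have sym: "transpose (H j) = H j" for j using trial by (simp add: mcrm_trial_def)
  have err: "norm (grad (objective F j) y - ?M j)
      \<le> (L / 2 + \<kappa>G * \<alpha> + \<kappa>H * \<alpha> + S / 2) * m\<^sup>2" for j
  proof -
    let ?f = "objective F j"
    have "norm (grad ?f y - grad ?f x - hess ?f x *v s) \<le> L / 2 * norm s ^ 2"
      using grad_taylor_bound[of ?f L x s] C2 lip by (auto simp: s_def twice_cont_diff_def)
    also have "\<dots> \<le> L / 2 * m\<^sup>2" using m2(1) by (rule mult_left_mono) (use const in simp)
    finally have 1: "norm (grad ?f y - grad ?f x - hess ?f x *v s) \<le> L / 2 * m\<^sup>2" .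
    have "norm (grad ?f x - g j) \<le> \<kappa>G * (\<alpha> / \<alpha> ^ i) * d\<^sup>2"
      using mcrm_trial_error(1)[OF trial] const by (simp add: d_def)
    also have "\<dots> \<le> \<kappa>G * \<alpha> * m\<^sup>2"
      by (rule mult_mono[OF mult_left_mono[OF c(1) const(2)] m2(2)]) (use const in simp_all)
    finally have 2: "norm (grad ?f x - g j) \<le> \<kappa>G * \<alpha> * m\<^sup>2" .
    have "norm ((hess ?f x - H j) *v s) \<le> matrix_opnorm (hess ?f x - H j) * norm s"
      by (rule matrix_opnorm_bound)
    also have "\<dots> \<le> (\<kappa>H * (\<alpha> / \<alpha> ^ i) * d) * norm s"
      unfolding d_def by (rule mult_right_mono[OF mcrm_trial_error(2)[OF trial]]) (use const in simp_all)
    also have "\<dots> = \<kappa>H * (\<alpha> / \<alpha> ^ i) * (d * norm s)" by simp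
    also have "\<dots> \<le> \<kappa>H * \<alpha> * m\<^sup>2"
      by (rule mult_mono[OF mult_left_mono[OF c(1) const(3)] m2(3)]) (use const(3,4) d in simp_all)
    finally have 3: "norm ((hess ?f x - H j) *v s) \<le> \<kappa>H * \<alpha> * m\<^sup>2" .
    have "norm ((S / 2 * norm s) *\<^sub>R s) = S / 2 * norm s ^ 2"
      using S0 by (simp add: power2_eq_square)
    also have "\<dots> \<le> S / 2 * m\<^sup>2" using S0 m2 by (intro mult_left_mono) auto
    finally have 4: "norm ((S / 2 * norm s) *\<^sub>R s) \<le> S / 2 * m\<^sup>2" .
    have "grad ?f y - ?M j = (grad ?f y - grad ?f x - hess ?f x *v s) + (grad ?f x - g j)
        + (hess ?f x - H j) *v s - (S / 2 * norm s) *\<^sub>R s"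
      by (simp add: grad_cubic_model[OF sym] s_def matrix_vector_mult_diff_rdistrib)
    also have "norm \<dots> \<le> L / 2 * m\<^sup>2 + \<kappa>G * \<alpha> * m\<^sup>2 + \<kappa>H * \<alpha> * m\<^sup>2 + S / 2 * m\<^sup>2"
      by (intro norm_triangle_mono norm_diff_triangle_le norm_triangle_le_diff 1 2 3 4
          order_trans[OF norm_triangle_ineq4] add_mono)
    finally show ?thesis by (simp add: algebra_simps)
  qed
  have "(\<Sum>j\<in>UNIV. l $ j *\<^sub>R grad (objective F j) y)
      = (\<Sum>j\<in>UNIV. l $ j *\<^sub>R ?M j) + (\<Sum>j\<in>UNIV. l $ j *\<^sub>R (grad (objective F j) y - ?M j))"
    by (simp flip: sum.distrib scaleR_add_right)
  also have "norm \<dots> \<le> \<theta> * m\<^sup>2 + (L / 2 + \<kappa>G * \<alpha> + \<kappa>H * \<alpha> + S / 2) * m\<^sup>2"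
  proof (rule norm_triangle_mono)
    have "norm (\<Sum>j\<in>UNIV. l $ j *\<^sub>R ?M j) \<le> \<theta> * norm s ^ 2"
      using trial by (simp add: mcrm_trial_def S_def s_def)
    also have "\<dots> \<le> \<theta> * m\<^sup>2" using m2(1) by (rule mult_left_mono) (use const in simp)
    finally show "norm (\<Sum>j\<in>UNIV. l $ j *\<^sub>R ?M j) \<le> \<theta> * m\<^sup>2" .
  qed (rule unit_simplex_norm_sum_le[OF l err])
  also have "\<dots> = (\<theta> + L / 2 + \<kappa>G * \<alpha> + \<kappa>H * \<alpha> + S / 2) * m\<^sup>2" by (simp add: algebra_simps)
  \<comment> \<open>The bound \<open>S \<le> \<alpha> * \<sigma>max\<close> turns the coefficient
    into the base of the power that defines \<open>\<Delta>0\<close>.\<close>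
  also have "\<dots> \<le> (L + 2 * \<theta> + (\<sigma>max + 2 * \<kappa>G + 2 * \<kappa>H) * \<alpha>) / 2 * m\<^sup>2"
    using S by (intro mult_right_mono) (auto simp: S_def algebra_simps)
  finally show thesis by (rule that[rotated]) (simp add: m_def max_def)
qed

section \<open>Bounds on the regularization parameter\<close>

text \<open>The starting index of the inner loop enforces the lower bound. For the upper bound,
  either the first trial is accepted and the parameter does not grow, or the preceding trial was
  rejected and its weight, which equals \<open>\<sigma>'\<close>, lies below the acceptance
  threshold.\<close>

lemma mcrm_step_accepted:
  assumes C2: "twice_cont_diff F"
    and lip: "\<And>j y z. matrix_opnorm (hess (objective F j) y - hess (objective F j) z) \<le> L * norm (y - z)"
    and const: "0 \<le> L" "0 \<le> \<kappa>G" "0 \<le> \<kappa>H" "1 < \<alpha>" "0 < \<sigma>1"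
    and \<sigma>: "\<sigma>1 \<le> \<sigma>" "\<sigma> \<le> \<sigma>max"
    and \<sigma>max: "\<sigma>max = \<sigma>1 + 2 * (L + 3 * \<alpha> * (2 * \<kappa>G + \<kappa>H))"
    and step: "mcrm_step F \<theta> \<alpha> \<kappa>G \<kappa>H \<sigma>1 xp x \<sigma> y l \<sigma>'"
  obtains i g H where "mcrm_trial F \<theta> \<alpha> \<kappa>G \<kappa>H xp x \<sigma> i g H y l" "mcrm_accept F \<alpha> xp x \<sigma> i y"
    "\<alpha> ^ i * \<sigma> = \<alpha> * \<sigma>'" "\<sigma>1 \<le> \<sigma>'" "\<sigma>' \<le> \<sigma>max"
proof -
  let ?P = "\<lambda>i::nat. \<alpha> powi (int i - 1) * \<sigma> \<ge> \<sigma>1"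
  define i0 where "i0 = (LEAST i. ?P i)"
  \<comment> \<open>At index 1 the condition is just \<open>\<sigma>1 \<le> \<sigma>\<close>; hence
    the least index exists and is 0 or 1.\<close>
  have "?P 1" using \<sigma> by simp
  then have i0: "?P i0" "i0 \<le> 1"
    unfolding i0_def by (rule LeastI, rule Least_le)
  obtain it g H X l' where it: "i0 \<le> it"
    and trial: "\<And>i. i \<in> {i0..it} \<Longrightarrow> mcrm_trial F \<theta> \<alpha> \<kappa>G \<kappa>H xp x \<sigma> i (g i) (H i) (X i) (l' i)"
    and reject: "\<And>i. i \<in> {i0..<it} \<Longrightarrow> \<not> mcrm_accept F \<alpha> xp x \<sigma> i (X i)"
    and accept: "mcrm_accept F \<alpha> xp x \<sigma> it (X it)"
    and eq: "y = X it" "l = l' it" "\<sigma>' = \<alpha> powi (int it - 1) * \<sigma>"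
    using step unfolding mcrm_step_def i0_def by blast
  have pos: "0 < \<sigma>" "0 < \<alpha>" using \<sigma> const by auto
  have powi: "\<alpha> powi (int i - 1) = \<alpha> ^ i / \<alpha>" for i
    using pos by (simp add: power_int_diff)
  have \<sigma>': "\<alpha> ^ it * \<sigma> = \<alpha> * \<sigma>'" using pos by (simp add: eq powi)
  have "\<alpha> ^ i0 / \<alpha> * \<sigma> \<le> \<alpha> ^ it / \<alpha> * \<sigma>"
    using power_increasing[OF it, of \<alpha>] pos const by (simp add: mult_right_mono divide_right_mono)
  then have lower: "\<sigma>1 \<le> \<sigma>'" using i0(1) by (simp add: eq powi)
  have upper: "\<sigma>' \<le> \<sigma>max"
  proof (cases "it = i0")
    case True
    then have "\<alpha> ^ it \<le> \<alpha> ^ 1" using i0 const by (intro power_increasing) auto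
    then have "\<alpha> ^ it * \<sigma> \<le> \<alpha> * \<sigma>" using pos by (intro mult_right_mono) auto
    then show ?thesis using \<sigma>' pos \<sigma> by simp
  next
    case False
    then obtain k where k: "it = Suc k" "i0 \<le> k" using it by (cases it) auto
    then have "\<not> mcrm_accept F \<alpha> xp x \<sigma> k (X k)" using reject by simp
    then have "\<not> 2 * (L + 3 * \<alpha> * (2 * \<kappa>G + \<kappa>H)) \<le> \<alpha> ^ k * \<sigma>"
      using mcrm_trial_accept[OF C2 lip const(1-4) pos(1) trial[of k]] k by auto
    then show ?thesis using \<sigma>' pos const \<sigma>max by (simp add: k)
  qed
  show thesis
    using that[of it "g it" "H it"] trial[of it] accept it \<sigma>' lower upper by (simp add: eq)
qed

section \<open>Telescoping, powers and counting\<close>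

text \<open>Splitting \<open>\<alpha>\<close> as \<open>(\<alpha> - 1) + 1\<close> leaves one part
  that telescopes and a surplus of at least \<open>(\<alpha> - 1) * \<sigma> 1 / 12\<close> times
  \<open>D\<close> per step.\<close>

lemma sum_telescope_bound:
  fixes D \<sigma> \<phi> :: "nat \<Rightarrow> real"
  assumes descent: "\<And>t. 1 \<le> t \<Longrightarrow> \<phi> t - \<phi> (Suc t) \<ge> \<alpha> * \<sigma> (Suc t) / 12 * D (Suc t) - \<sigma> t / 12 * D t"
    and \<sigma>: "\<And>t. 1 \<le> t \<Longrightarrow> \<sigma> 1 \<le> \<sigma> t" and D: "\<And>t. 0 \<le> D t"
    and \<alpha>: "1 < \<alpha>" "0 < \<sigma> 1" and lower: "\<And>t. c \<le> \<phi> t" and "1 \<le> T"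
  shows "(\<Sum>t=2..T. D t) \<le> 12 * (\<phi> 1 - c) / ((\<alpha> - 1) * \<sigma> 1) + D 1 / (\<alpha> - 1)"
proof -
  \<comment> \<open>The invariant keeps \<open>\<sigma> T / 12 * D T\<close> on the left: it is
    exactly what the next descent inequality gives away.\<close>
  have "(\<alpha> - 1) * \<sigma> 1 / 12 * (\<Sum>t=2..T. D t) + \<sigma> T / 12 * D T \<le> \<phi> 1 - \<phi> T + \<sigma> 1 / 12 * D 1"
    using \<open>1 \<le> T\<close>
  proof (induction T rule: dec_induct)
    case (step T)
    have "(\<alpha> - 1) * \<sigma> 1 / 12 * D (Suc T) \<le> (\<alpha> - 1) * \<sigma> (Suc T) / 12 * D (Suc T)"
      using \<alpha> D \<sigma>[of "Suc T"] by (intro mult_right_mono divide_right_mono mult_left_mono) auto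
    moreover have "\<alpha> * \<sigma> (Suc T) / 12 * D (Suc T)
        = (\<alpha> - 1) * \<sigma> (Suc T) / 12 * D (Suc T) + \<sigma> (Suc T) / 12 * D (Suc T)"
      by (simp add: left_diff_distrib diff_divide_distrib)
    moreover have "(\<alpha> - 1) * \<sigma> 1 / 12 * (\<Sum>t=2..Suc T. D t)
        = (\<alpha> - 1) * \<sigma> 1 / 12 * (\<Sum>t=2..T. D t) + (\<alpha> - 1) * \<sigma> 1 / 12 * D (Suc T)"
      using step.hyps by (simp add: distrib_left)
    ultimately show ?case using step.IH descent[OF step.hyps(1)] by linarith
  qed simp
  moreover have "0 \<le> \<sigma> T / 12 * D T" using D \<alpha> \<sigma>[OF \<open>1 \<le> T\<close>] by simp
  ultimately have "(\<alpha> - 1) * \<sigma> 1 / 12 * (\<Sum>t=2..T. D t) \<le> \<phi> 1 - c + \<sigma> 1 / 12 * D 1"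
    using lower[of T] by linarith
  then have "(\<Sum>t=2..T. D t) \<le> (\<phi> 1 - c + \<sigma> 1 / 12 * D 1) / ((\<alpha> - 1) * \<sigma> 1 / 12)"
    using \<alpha> by (subst pos_le_divide_eq) (auto simp: mult.commute)
  also have "\<dots> = 12 * (\<phi> 1 - c) / ((\<alpha> - 1) * \<sigma> 1) + D 1 / (\<alpha> - 1)"
    using \<alpha> by (simp add: divide_simps) (simp add: algebra_simps)
  finally show ?thesis .
qed

lemma powr_three_halves_bound:
  fixes a b C m v :: real
  assumes "0 \<le> v" "v \<le> C * m\<^sup>2" "0 \<le> C" "0 \<le> a" "0 \<le> b" and m: "m \<in> {a, b}"
  shows "v powr (3/2) \<le> C powr (3/2) * (a ^ 3 + b ^ 3)"
proof -
  have "0 \<le> m" using m assms(4,5) by blast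
  have "v powr (3/2) \<le> (C * m\<^sup>2) powr (3/2)"
    by (rule powr_mono2) (use assms(1,2) in simp_all)
  also have "\<dots> = C powr (3/2) * m ^ 3"
  proof (cases "m = 0")
    case False
    then have "0 < m" using \<open>0 \<le> m\<close> by simp
    then have "(m\<^sup>2) powr (3/2) = m ^ 3" by (simp add: powr_powr flip: powr_numeral)
    then show ?thesis using \<open>0 \<le> C\<close> by (simp add: powr_mult)
  qed simp
  also have "m ^ 3 \<le> a ^ 3 + b ^ 3"
    using m assms(4,5) by fastforce
  finally show ?thesis by (simp add: mult_left_mono)
qed

text \<open>If all terms up to the first integer \<open>N\<close> above
  \<open>B * \<epsilon> powr (- p)\<close> exceeded \<open>\<epsilon>\<close>, their powers would
  sum to more than \<open>B\<close>.\<close>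

lemma exists_small_of_sum_powr_bound:
  fixes v :: "nat \<Rightarrow> real"
  assumes bound: "\<And>N. (\<Sum>k=1..N. v k powr p) \<le> B" and "0 < \<epsilon>" "0 < p"
  obtains k where "1 \<le> k" "real k \<le> B * \<epsilon> powr (- p) + 1" "v k \<le> \<epsilon>"
proof (rule ccontr)
  assume "\<not> thesis"
  with that have none: "\<epsilon> < v k" if "1 \<le> k" "real k \<le> B * \<epsilon> powr (- p) + 1" for k
    using that(1,2) not_less by blast
  let ?b = "B * \<epsilon> powr (- p)"
  define N where "N = nat \<lfloor>?b\<rfloor> + 1"
  \<comment> \<open>The empty sum gives the sign of \<open>B\<close>, so \<open>nat\<close> does not
    truncate the floor.\<close>
  have "0 \<le> B" using bound[of 0] by simp
  then have "0 \<le> ?b" by simp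
  then have N: "real N \<le> ?b + 1" "?b < real N" unfolding N_def by linarith+
  have "\<epsilon> powr p \<le> v k powr p" if "k \<in> {1..N}" for k
  proof (rule powr_mono2)
    have "real k \<le> ?b + 1" using that N by simp
    then show "\<epsilon> \<le> v k" using none that by (simp add: less_imp_le)
  qed (use assms in simp_all)
  then have "real N * \<epsilon> powr p \<le> (\<Sum>k=1..N. v k powr p)"
    using sum_bounded_below[of "{1..N}" "\<epsilon> powr p" "\<lambda>k. v k powr p"] by simp
  then have "real N * \<epsilon> powr p \<le> B" using bound[of N] by linarith
  then have "real N \<le> ?b" using assms by (simp add: powr_minus field_simps)
  then show False using N by simp
qed

section \<open>Estimates along the generated sequence\<close>

text \<open>Descent holds in every component, so the argument runs with a fixed \<open>j\<close>
  that can be chosen afterwards. Index \<open>Suc t\<close> pairs iteration \<open>t\<close> with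
  the iterate it produces.\<close>

lemma mcrm_bounds:
  fixes F :: "real^'n \<Rightarrow> real^'m" and x :: "nat \<Rightarrow> real^'n"
  defines "d \<equiv> \<lambda>t. norm (x t - x (t - 1))"
  assumes C2: "twice_cont_diff F"
    and lip: "\<And>j y z. matrix_opnorm (hess (objective F j) y - hess (objective F j) z) \<le> L * norm (y - z)"
    and A2: "\<And>y. F y $ j \<ge> Fmin"
    and alg: "mcrm_generates F \<theta> \<alpha> \<kappa>G \<kappa>H x lam \<sigma>"
    and \<sigma>max: "\<sigma>max = \<sigma> 1 + 2 * (L + 3 * \<alpha> * (2 * \<kappa>G + \<kappa>H))"
    and \<Delta>0: "\<Delta>0 = ((L + 2 * \<theta> + (\<sigma>max + 2 * \<kappa>G + 2 * \<kappa>H) * \<alpha>) / 2) powr (3/2)"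
    and \<Delta>1: "\<Delta>1 = 24 * (F (x 1) $ j - Fmin) / ((\<alpha> - 1) * \<sigma> 1) + (\<alpha> + 1) / (\<alpha> - 1) * d 1 ^ 3"
  obtains "\<And>t. 1 \<le> t \<Longrightarrow> lam (Suc t) \<in> unit_simplex"
    and "\<And>T. 1 \<le> T \<Longrightarrow> (\<Sum>t=1..T. d t ^ 3) \<le> \<Delta>1"
    and "\<And>T. (\<Sum>t=1..T. norm (\<Sum>j\<in>UNIV. (lam (Suc t) $ j) *\<^sub>R grad (objective F j) (x (Suc t))) powr (3/2))
      \<le> \<Delta>0 * \<Delta>1"
proof -
  define C where "C = (L + 2 * \<theta> + (\<sigma>max + 2 * \<kappa>G + 2 * \<kappa>H) * \<alpha>) / 2"
  define G where "G t = norm (\<Sum>j\<in>UNIV. (lam t $ j) *\<^sub>R grad (objective F j) (x t))" for t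
  have d_nonneg: "0 \<le> d t" for t by (simp add: d_def)
  have const: "0 < \<sigma> 1" "0 \<le> \<theta>" "1 < \<alpha>" "0 \<le> \<kappa>G" "0 \<le> \<kappa>H"
    and step: "\<And>t. 1 \<le> t \<Longrightarrow> mcrm_step F \<theta> \<alpha> \<kappa>G \<kappa>H (\<sigma> 1) (x (t - 1)) (x t) (\<sigma> t)
              (x (Suc t)) (lam (Suc t)) (\<sigma> (Suc t))"
    using alg by (simp_all add: mcrm_generates_def)
  \<comment> \<open>The Lipschitz estimate between a unit vector and the origin forces this
    sign.\<close>
  have "0 \<le> L"
  proof -
    have "0 \<le> L * norm (axis undefined 1 - 0 :: real^'n)"
      by (rule order_trans[OF matrix_opnorm_nonneg lip])
    then show ?thesis by simp
  qed
  note accepted = mcrm_step_accepted[OF C2 lip \<open>0 \<le> L\<close> const(4,5,3,1) _ _ \<sigma>max step]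
  have \<sigma>: "\<sigma> 1 \<le> \<sigma> t \<and> \<sigma> t \<le> \<sigma>max" if "1 \<le> t" for t
    using that
  proof (induction t rule: dec_induct)
    case base
    show ?case using \<open>0 \<le> L\<close> const by (simp add: \<sigma>max)
  next
    case (step t)
    then show ?case using accepted[of t] by blast
  qed
  have C: "0 \<le> C" unfolding C_def using \<open>0 \<le> L\<close> const \<sigma>[of 1] by simp
  have descent: "F (x t) $ k - F (x (Suc t)) $ k
      \<ge> \<alpha> * \<sigma> (Suc t) / 12 * d (Suc t) ^ 3 - \<sigma> t / 12 * d t ^ 3" if "1 \<le> t" for t k
    by (rule accepted[of t])
       (use that \<sigma>[OF that] in \<open>simp_all add: mcrm_accept_def d_def\<close>)
  have simplex: "lam (Suc t) \<in> unit_simplex" if "1 \<le> t" for t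
    by (rule accepted[of t]) (use that \<sigma>[OF that] in \<open>simp_all add: mcrm_trial_def\<close>)
  have gradient: "G (Suc t) powr (3/2) \<le> \<Delta>0 * (d t ^ 3 + d (Suc t) ^ 3)" if t: "1 \<le> t" for t
  proof (rule accepted[of t])
    fix i g H
    assume trial: "mcrm_trial F \<theta> \<alpha> \<kappa>G \<kappa>H (x (t - 1)) (x t) (\<sigma> t) i g H (x (Suc t)) (lam (Suc t))"
      and S: "\<alpha> ^ i * \<sigma> t = \<alpha> * \<sigma> (Suc t)" and "\<sigma> (Suc t) \<le> \<sigma>max"
    have "0 < \<sigma> t" "\<alpha> ^ i * \<sigma> t \<le> \<alpha> * \<sigma>max"
      using S \<open>\<sigma> (Suc t) \<le> \<sigma>max\<close> const \<sigma>[OF t] by simp_all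
    then obtain m where m: "m \<in> {d t, d (Suc t)}" "G (Suc t) \<le> C * m\<^sup>2"
      by (rule mcrm_trial_gradient_bound[OF C2 lip \<open>0 \<le> L\<close> const(4,5,3,2) _ trial])
         (simp add: d_def G_def C_def)
    show ?thesis unfolding \<Delta>0 C_def[symmetric]
      by (rule powr_three_halves_bound[OF _ m(2) C d_nonneg d_nonneg m(1)]) (simp add: G_def)
  qed (use t \<sigma>[OF t] in simp_all)
  define A where "A = 12 * (F (x 1) $ j - Fmin) / ((\<alpha> - 1) * \<sigma> 1)"
  have tail: "(\<Sum>t=2..T. d t ^ 3) \<le> A + d 1 ^ 3 / (\<alpha> - 1)" if "1 \<le> T" for T
    unfolding A_def
    by (rule sum_telescope_bound[where \<phi> = "\<lambda>t. F (x t) $ j" and D = "\<lambda>t. d t ^ 3" and \<sigma> = \<sigma>,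
          OF descent _ _ const(3,1) A2 that])
       (use \<sigma> d_nonneg in simp_all)
  \<comment> \<open>\<open>\<Delta>1\<close> splits into a bound for the cubes from index 1 and one
    for the cubes from index 2, because the gradient estimate charges both \<open>d t\<close> and
    \<open>d (Suc t)\<close>.\<close>
  have \<Delta>1': "\<Delta>1 = (A + d 1 ^ 3 / (\<alpha> - 1) + d 1 ^ 3) + (A + d 1 ^ 3 / (\<alpha> - 1))"
  proof -
    have "(\<alpha> + 1) / (\<alpha> - 1) = 1 + 2 / (\<alpha> - 1)" using const by (simp add: field_simps)
    then show ?thesis by (simp only: \<Delta>1) (simp add: A_def distrib_right)
  qed
  have head: "(\<Sum>t=1..T. d t ^ 3) \<le> A + d 1 ^ 3 / (\<alpha> - 1) + d 1 ^ 3" if "1 \<le> T" for T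
    using tail[OF that] that by (simp add: sum.atLeast_Suc_atMost numeral_2_eq_2)
  \<comment> \<open>For \<open>T = 1\<close> the sum in \<open>tail\<close> is empty, so the second
    half of \<open>\<Delta>1\<close> is nonnegative.\<close>
  have steps: "(\<Sum>t=1..T. d t ^ 3) \<le> \<Delta>1" if "1 \<le> T" for T
    using head[OF that] tail[of 1] by (simp add: \<Delta>1')
  have "0 \<le> \<Delta>1" using d_nonneg
    by (intro order_trans[OF sum_nonneg steps[of 1]]) simp_all
  have "(\<Sum>t=1..T. G (Suc t) powr (3/2)) \<le> (\<Sum>t=1..T. \<Delta>0 * (d t ^ 3 + d (Suc t) ^ 3))" for T
    by (intro sum_mono gradient) simp
  also have "(\<Sum>t=1..T. \<Delta>0 * (d t ^ 3 + d (Suc t) ^ 3)) \<le> \<Delta>0 * \<Delta>1" for T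
  \<comment> \<open>For \<open>T = 0\<close> the sum is empty and only the sign of
    \<open>\<Delta>0 * \<Delta>1\<close> matters.\<close>
  proof (cases "1 \<le> T")
    case True
    have "(\<Sum>t=1..T. d (Suc t) ^ 3) = (\<Sum>t=2..Suc T. d t ^ 3)"
      unfolding numeral_2_eq_2 One_nat_def by (rule sum.shift_bounds_cl_Suc_ivl[symmetric])
    then have "(\<Sum>t=1..T. d t ^ 3) + (\<Sum>t=1..T. d (Suc t) ^ 3) \<le> \<Delta>1"
      unfolding \<Delta>1' using head[OF True] tail[of "Suc T"] by simp
    then show ?thesis
      unfolding sum_distrib_left[symmetric] sum.distrib by (rule mult_left_mono) (simp add: \<Delta>0)
  qed (use \<open>0 \<le> \<Delta>1\<close> in \<open>simp add: \<Delta>0\<close>)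
  finally have grads: "(\<Sum>t=1..T. G (Suc t) powr (3/2)) \<le> \<Delta>0 * \<Delta>1" for T .
  show thesis
    by (rule that[OF simplex steps grads[unfolded G_def]])
qed

theorem theorem3p3:
  fixes F :: "real^'n \<Rightarrow> real^'m"
    and Lip Fstar :: "'m \<Rightarrow> real"
    and L \<theta> \<alpha> \<kappa>G \<kappa>H \<sigma>max \<Delta>0 \<Delta>1 :: real
    and x :: "nat \<Rightarrow> real^'n"
    and lam :: "nat \<Rightarrow> real^'m"
    and \<sigma> :: "nat \<Rightarrow> real"
  assumes C2: "twice_cont_diff F"
    and A1: "\<And>j y z. matrix_opnorm (hess (objective F j) y - hess (objective F j) z)
                        \<le> Lip j * norm (y - z)"
    and A2: "\<And>j y. F y $ j \<ge> Fstar j"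
    and alg: "mcrm_generates F \<theta> \<alpha> \<kappa>G \<kappa>H x lam \<sigma>"
    and L: "L = Max (range Lip)"
    and \<sigma>max: "\<sigma>max = \<sigma> 1 + 2 * (L + 3 * \<alpha> * (2 * \<kappa>G + \<kappa>H))"
    and \<Delta>0: "\<Delta>0 = ((L + 2 * \<theta> + (\<sigma>max + 2 * \<kappa>G + 2 * \<kappa>H) * \<alpha>) / 2) powr (3/2)"
    and \<Delta>1: "\<Delta>1 = 24 * Min (range (\<lambda>j. F (x 1) $ j - Fstar j)) / ((\<alpha> - 1) * \<sigma> 1)
                  + (\<alpha> + 1) / (\<alpha> - 1) * norm (x 1 - x 0) ^ 3"
  shows "(\<forall>T\<ge>2.
            (\<Sum>t=1..T-1. norm (x t - x (t - 1)) ^ 3) \<le> \<Delta>1 \<and>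
            (\<Sum>t=2..T. norm (\<Sum>j\<in>UNIV. (lam t $ j) *\<^sub>R grad (objective F j) (x t)) powr (3/2))
              \<le> \<Delta>0 * \<Delta>1) \<and>
         (\<forall>\<epsilon>>0. \<exists>k\<ge>1. real k \<le> \<Delta>0 * \<Delta>1 * \<epsilon> powr (-3/2) + 1 \<and>
            approx_Pareto_critical F \<epsilon> (x (k + 1)))"
proof -
  have lip: "matrix_opnorm (hess (objective F j) y - hess (objective F j) z) \<le> L * norm (y - z)" for j y z
  proof -
    have "Lip j * norm (y - z) \<le> L * norm (y - z)"
      unfolding L by (intro mult_right_mono) auto
    then show ?thesis using A1[of j y z] by linarith
  qed
  \<comment> \<open>The minimum in \<open>\<Delta>1\<close> is attained at some component, which is
    the one to telescope.\<close>
  have "Min (range (\<lambda>j. F (x 1) $ j - Fstar j)) \<in> range (\<lambda>j. F (x 1) $ j - Fstar j)"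
    by (rule Min_in) simp_all
  then obtain j where j: "Min (range (\<lambda>j. F (x 1) $ j - Fstar j)) = F (x 1) $ j - Fstar j"
    by blast
  have "\<Delta>1 = 24 * (F (x 1) $ j - Fstar j) / ((\<alpha> - 1) * \<sigma> 1)
      + (\<alpha> + 1) / (\<alpha> - 1) * norm (x 1 - x (1 - 1)) ^ 3"
    unfolding \<Delta>1 j by simp
  note bounds = mcrm_bounds[OF C2 lip A2 alg \<sigma>max \<Delta>0 this]
  let ?G = "\<lambda>t. norm (\<Sum>j\<in>UNIV. (lam t $ j) *\<^sub>R grad (objective F j) (x t))"
  have simplex: "lam (Suc t) \<in> unit_simplex" if "1 \<le> t" for t
    by (rule bounds) (use that in blast)
  have steps: "(\<Sum>t=1..T. norm (x t - x (t - 1)) ^ 3) \<le> \<Delta>1" if "1 \<le> T" for T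
    by (rule bounds) (use that in blast)
  have grads: "(\<Sum>t=1..T. ?G (Suc t) powr (3/2)) \<le> \<Delta>0 * \<Delta>1" for T
    by (rule bounds)
  show ?thesis
  proof (intro conjI allI impI)
    fix T :: nat assume T: "2 \<le> T"
    show "(\<Sum>t=1..T-1. norm (x t - x (t - 1)) ^ 3) \<le> \<Delta>1"
      by (rule steps) (use T in simp)
    have "(\<Sum>t=2..T. ?G t powr (3/2)) = (\<Sum>t=Suc 1..Suc (T - 1). ?G t powr (3/2))"
      using T by (simp only: numeral_2_eq_2) simp
    also have "\<dots> = (\<Sum>t=1..T-1. ?G (Suc t) powr (3/2))"
      by (rule sum.shift_bounds_cl_Suc_ivl)
    finally show "(\<Sum>t=2..T. ?G t powr (3/2)) \<le> \<Delta>0 * \<Delta>1"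
      using grads[of "T - 1"] by (simp only:)
  next
    fix \<epsilon> :: real assume "0 < \<epsilon>"
    then obtain k where k: "1 \<le> k" "real k \<le> \<Delta>0 * \<Delta>1 * \<epsilon> powr (- (3/2)) + 1" "?G (Suc k) \<le> \<epsilon>"
      by (rule exists_small_of_sum_powr_bound[OF grads]) simp
    \<comment> \<open>The multipliers computed by the algorithm serve as the certificate. Since
      \<open>x (k + 1)\<close> is the output of outer iteration \<open>k\<close>, the bound on
      \<open>k\<close> counts iterations.\<close>
    have "approx_Pareto_critical F \<epsilon> (x (k + 1))"
      unfolding approx_Pareto_critical_def Suc_eq_plus1[symmetric]
      using k(3) simplex[OF k(1)] by (rule bexI[where x = "lam (Suc k)"])
    then show "\<exists>k\<ge>1. real k \<le> \<Delta>0 * \<Delta>1 * \<epsilon> powr (-3/2) + 1 \<and> approx_Pareto_critical F \<epsilon> (x (k + 1))"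
      using k by (intro exI[of _ k]) simp
  qed
qed

end
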